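(* Let $\mathcal{C}$ be a class of propositional formulas (in negation normal form) that is closed under subformulas and complementation, and let $\mathcal{C}'$ be the closure of $\mathcal{C}$ under disjunctions. Let $A_1,\dots,A_m$ and $A$ be formulas in $\mathcal{C}'$. If $A_1,\dots,A_m$ logically imply $A$, then there is a $\mathcal{C}'$-Frege proof of $A$ from $A_1,\dots,A_m$. Moreover, if the formulas $A_1,\dots,A_m,A$ have $n$ variables and size at most $s$, then the size of the proof is at most polynomial in $n$, $s$, $m$, $2^n$ and $s^m$.
   Context: Formulas are built from literals $X,\overline{X}$ with $\wedge,\vee$ (considered commutative, associative and idempotent) and the constants $0$ (empty formula, false) and $1$ (true), with $0\vee A=A$, $1\wedge A=A$, $0\wedge A=0$, $1\vee A=1$. The complement $\overline{A}$ is defined by De Morgan: $\overline{\overline X}=X$, $\overline{C\wedge D}=\overline C\vee\overline D$, $\overline{C\vee D}=\overline C\wedge\overline D$. Size: $s(0)=s(1)=0$, $s(\text{literal})=1$, $s(C\circ D)=s(C)+s(D)+1$. Frege has the rules: axiom $A\vee\overline A$; cut: from $C\vee A$ and $D\vee\overline A$ infer $C\vee D$; introduction of conjunction: from $C\vee A$ and $D\vee B$ infer $C\vee D\vee(A\wedge B)$; weakening: from $C$ infer $C\vee D$ ($C,D$ may be $0$ or $1$). A Frege proof from $F$ may use formulas of $F$ as additional axioms. A $\mathcal{C}'$-Frege proof is one all of whose formulas are in $\mathcal{C}'$. The size of a proof is the sum of the sizes of its formulas. *)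

theory Defs
  imports Main
begin

datatype 'v expr =
    EZero
  | EOne
  | EPos 'v
  | ENeg 'v
  | EAnd "'v expr" "'v expr"
  | EOr "'v expr" "'v expr"

inductive expr_eq :: "'v expr \<Rightarrow> 'v expr \<Rightarrow> bool" where
  refl: "expr_eq a a"
| sym: "expr_eq a b \<Longrightarrow> expr_eq b a"
| trans: "expr_eq a b \<Longrightarrow> expr_eq b c \<Longrightarrow> expr_eq a c"
| and_cong: "expr_eq a a' \<Longrightarrow> expr_eq b b' \<Longrightarrow> expr_eq (EAnd a b) (EAnd a' b')"
| or_cong: "expr_eq a a' \<Longrightarrow> expr_eq b b' \<Longrightarrow> expr_eq (EOr a b) (EOr a' b')"
| and_comm: "expr_eq (EAnd a b) (EAnd b a)"
| or_comm: "expr_eq (EOr a b) (EOr b a)"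
| and_assoc: "expr_eq (EAnd (EAnd a b) c) (EAnd a (EAnd b c))"
| or_assoc: "expr_eq (EOr (EOr a b) c) (EOr a (EOr b c))"
| and_idem: "expr_eq (EAnd a a) a"
| or_idem: "expr_eq (EOr a a) a"
| or_zero: "expr_eq (EOr EZero a) a"
| and_one: "expr_eq (EAnd EOne a) a"
| and_zero: "expr_eq (EAnd EZero a) EZero"
| or_one: "expr_eq (EOr EOne a) EOne"

lemma equivp_expr_eq: "equivp expr_eq"
  by (rule equivpI) (auto intro: reflpI sympI transpI expr_eq.refl expr_eq.sym expr_eq.trans)

primrec eneg :: "'v expr \<Rightarrow> 'v expr" where
  "eneg EZero = EOne"
| "eneg EOne = EZero"
| "eneg (EPos x) = ENeg x"
| "eneg (ENeg x) = EPos x"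
| "eneg (EAnd a b) = EOr (eneg a) (eneg b)"
| "eneg (EOr a b) = EAnd (eneg a) (eneg b)"

primrec eeval :: "('v \<Rightarrow> bool) \<Rightarrow> 'v expr \<Rightarrow> bool" where
  "eeval \<alpha> EZero = False"
| "eeval \<alpha> EOne = True"
| "eeval \<alpha> (EPos x) = \<alpha> x"
| "eeval \<alpha> (ENeg x) = (\<not> \<alpha> x)"
| "eeval \<alpha> (EAnd a b) = (eeval \<alpha> a \<and> eeval \<alpha> b)"
| "eeval \<alpha> (EOr a b) = (eeval \<alpha> a \<or> eeval \<alpha> b)"

primrec esize :: "'v expr \<Rightarrow> nat" where
  "esize EZero = 0"
| "esize EOne = 0"
| "esize (EPos x) = 1"
| "esize (ENeg x) = 1"
| "esize (EAnd a b) = esize a + esize b + 1"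
| "esize (EOr a b) = esize a + esize b + 1"

primrec evars :: "'v expr \<Rightarrow> 'v set" where
  "evars EZero = {}"
| "evars EOne = {}"
| "evars (EPos x) = {x}"
| "evars (ENeg x) = {x}"
| "evars (EAnd a b) = evars a \<union> evars b"
| "evars (EOr a b) = evars a \<union> evars b"

primrec esubs :: "'v expr \<Rightarrow> 'v expr set" where
  "esubs EZero = {EZero}"
| "esubs EOne = {EOne}"
| "esubs (EPos x) = {EPos x}"
| "esubs (ENeg x) = {ENeg x}"
| "esubs (EAnd a b) = insert (EAnd a b) (esubs a \<union> esubs b)"
| "esubs (EOr a b) = insert (EOr a b) (esubs a \<union> esubs b)"

text \<open>A formula is an expression modulo associativity, commutativity and idempotence of
  both connectives and the laws for the constants, so that these laws are equalities.\<close>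

quotient_type 'v formula = "'v expr" / expr_eq
  by (rule equivp_expr_eq)

lift_definition Zero :: "'v formula" is EZero .
lift_definition One :: "'v formula" is EOne .
lift_definition Pos :: "'v \<Rightarrow> 'v formula" is EPos .
lift_definition Neg :: "'v \<Rightarrow> 'v formula" is ENeg .

lift_definition Conj :: "'v formula \<Rightarrow> 'v formula \<Rightarrow> 'v formula"  (infixr "\<^bold>\<and>" 70)
  is EAnd by (rule expr_eq.and_cong)

lift_definition Disj :: "'v formula \<Rightarrow> 'v formula \<Rightarrow> 'v formula"  (infixr "\<^bold>\<or>" 65)
  is EOr by (rule expr_eq.or_cong)

lift_definition compl :: "'v formula \<Rightarrow> 'v formula" is eneg
proof -
  fix a b :: "'v expr"
  assume "expr_eq a b"
  then show "expr_eq (eneg a) (eneg b)"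
  proof induction
    case (sym a b)
    from sym.IH show ?case by (rule expr_eq.sym)
  next
    case (trans a b c)
    from trans.IH show ?case by (rule expr_eq.trans)
  qed (simp_all add: expr_eq.refl expr_eq.and_cong expr_eq.or_cong expr_eq.and_comm expr_eq.or_comm
      expr_eq.and_assoc expr_eq.or_assoc expr_eq.and_idem expr_eq.or_idem expr_eq.or_zero
      expr_eq.and_one expr_eq.and_zero expr_eq.or_one)
qed

lift_definition holds :: "('v \<Rightarrow> bool) \<Rightarrow> 'v formula \<Rightarrow> bool" is eeval
proof -
  fix \<alpha> :: "'v \<Rightarrow> bool" and a b :: "'v expr"
  assume "expr_eq a b"
  then show "eeval \<alpha> a = eeval \<alpha> b"
    by induction auto
qed

lemma Disj_commute: "A \<^bold>\<or> B = B \<^bold>\<or> A"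
  by transfer (rule expr_eq.or_comm)

lemma Disj_assoc: "(A \<^bold>\<or> B) \<^bold>\<or> D = A \<^bold>\<or> (B \<^bold>\<or> D)"
  by transfer (rule expr_eq.or_assoc)

lemma Disj_idem [simp]: "A \<^bold>\<or> A = A"
  by transfer (rule expr_eq.or_idem)

lemma Conj_commute: "A \<^bold>\<and> B = B \<^bold>\<and> A"
  by transfer (rule expr_eq.and_comm)

lemma Conj_assoc: "(A \<^bold>\<and> B) \<^bold>\<and> D = A \<^bold>\<and> (B \<^bold>\<and> D)"
  by transfer (rule expr_eq.and_assoc)

lemma Conj_idem [simp]: "A \<^bold>\<and> A = A"
  by transfer (rule expr_eq.and_idem)

lemma Zero_Disj [simp]: "Zero \<^bold>\<or> A = A"
  by transfer (rule expr_eq.or_zero)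

lemma One_Conj [simp]: "One \<^bold>\<and> A = A"
  by transfer (rule expr_eq.and_one)

lemma Zero_Conj [simp]: "Zero \<^bold>\<and> A = Zero"
  by transfer (rule expr_eq.and_zero)

lemma One_Disj [simp]: "One \<^bold>\<or> A = One"
  by transfer (rule expr_eq.or_one)

lemma compl_simps [simp]:
  "compl Zero = One" "compl One = Zero" "compl (Pos x) = Neg x" "compl (Neg x) = Pos x"
  "compl (A \<^bold>\<and> B) = compl A \<^bold>\<or> compl B" "compl (A \<^bold>\<or> B) = compl A \<^bold>\<and> compl B"
  by (transfer, simp add: expr_eq.refl)+

text \<open>Size, variables and subformulas depend on how a formula is written. They are read off
  expressions in which the constants have been simplified away; without this restriction every
  formula would be a subformula of \<open>Zero\<close>, because \<open>Zero \<^bold>\<and> A = Zero\<close>.\<close>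

primrec const_free :: "'v expr \<Rightarrow> bool" where
  "const_free EZero = False"
| "const_free EOne = False"
| "const_free (EPos x) = True"
| "const_free (ENeg x) = True"
| "const_free (EAnd a b) = (const_free a \<and> const_free b)"
| "const_free (EOr a b) = (const_free a \<and> const_free b)"

definition reduced :: "'v expr \<Rightarrow> bool" where
  "reduced a \<longleftrightarrow> a = EZero \<or> a = EOne \<or> const_free a"

definition exprs :: "'v formula \<Rightarrow> 'v expr set" where
  "exprs F = {a. reduced a \<and> abs_formula a = F}"

text \<open>Because of idempotence (\<open>A \<^bold>\<or> A = A\<close>) different expressions of the same formula may
  have different sizes; the size of a formula is that of its shortest expression.\<close>

definition fsize :: "'v formula \<Rightarrow> nat" where
  "fsize F = (LEAST k. \<exists>a \<in> exprs F. esize a = k)"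

definition vars :: "'v formula \<Rightarrow> 'v set" where
  "vars F = (\<Union>a \<in> exprs F. evars a)"

definition subformulas :: "'v formula \<Rightarrow> 'v formula set" where
  "subformulas F = (\<Union>a \<in> exprs F. abs_formula ` esubs a)"

primrec ereduce :: "'v expr \<Rightarrow> 'v expr" where
  "ereduce EZero = EZero"
| "ereduce EOne = EOne"
| "ereduce (EPos x) = EPos x"
| "ereduce (ENeg x) = ENeg x"
| "ereduce (EAnd a b) =
     (if ereduce a = EZero \<or> ereduce b = EZero then EZero
      else if ereduce a = EOne then ereduce b
      else if ereduce b = EOne then ereduce a
      else EAnd (ereduce a) (ereduce b))"
| "ereduce (EOr a b) =
     (if ereduce a = EOne \<or> ereduce b = EOne then EOne
      else if ereduce a = EZero then ereduce b
      else if ereduce b = EZero then ereduce a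
      else EOr (ereduce a) (ereduce b))"

lemma reduced_ereduce: "reduced (ereduce a)"
  by (induction a) (auto simp: reduced_def)

lemma ereduce_id: "reduced a \<Longrightarrow> ereduce a = a"
proof -
  have "const_free a \<Longrightarrow> ereduce a = a \<and> a \<noteq> EZero \<and> a \<noteq> EOne"
    by (induction a) auto
  then show "reduced a \<Longrightarrow> ereduce a = a"
    by (auto simp: reduced_def)
qed

lemma expr_eq_ereduce: "expr_eq (ereduce a) a"
proof (induction a)
  case (EAnd a b)
  have *: "expr_eq (EAnd (ereduce a) (ereduce b)) (EAnd a b)"
    using EAnd by (rule expr_eq.and_cong)
  have "expr_eq (ereduce (EAnd a b)) (EAnd (ereduce a) (ereduce b))"
  proof -
    have laws: "expr_eq EZero (EAnd EZero c)" "expr_eq EZero (EAnd c EZero)"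
      "expr_eq c (EAnd EOne c)" "expr_eq c (EAnd c EOne)" for c :: "'a expr"
      by (rule expr_eq.sym[OF expr_eq.and_zero]
          expr_eq.sym[OF expr_eq.trans[OF expr_eq.and_comm expr_eq.and_zero]]
          expr_eq.sym[OF expr_eq.and_one]
          expr_eq.sym[OF expr_eq.trans[OF expr_eq.and_comm expr_eq.and_one]])+
    show ?thesis
      by (simp add: laws expr_eq.refl)
  qed
  then show ?case
    using * by (rule expr_eq.trans)
next
  case (EOr a b)
  have *: "expr_eq (EOr (ereduce a) (ereduce b)) (EOr a b)"
    using EOr by (rule expr_eq.or_cong)
  have "expr_eq (ereduce (EOr a b)) (EOr (ereduce a) (ereduce b))"
  proof -
    have laws: "expr_eq EOne (EOr EOne c)" "expr_eq EOne (EOr c EOne)"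
      "expr_eq c (EOr EZero c)" "expr_eq c (EOr c EZero)" for c :: "'a expr"
      by (rule expr_eq.sym[OF expr_eq.or_one]
          expr_eq.sym[OF expr_eq.trans[OF expr_eq.or_comm expr_eq.or_one]]
          expr_eq.sym[OF expr_eq.or_zero]
          expr_eq.sym[OF expr_eq.trans[OF expr_eq.or_comm expr_eq.or_zero]])+
    show ?thesis
      by (simp add: laws expr_eq.refl)
  qed
  then show ?case
    using * by (rule expr_eq.trans)
qed (simp_all add: expr_eq.refl)

lemma exprs_nonempty: "exprs F \<noteq> {}"
proof -
  obtain a where "F = abs_formula a"
    by (rule that[OF Quotient3_abs_rep[OF Quotient3_formula, symmetric]])
  then have "ereduce a \<in> exprs F"
    by (simp add: exprs_def reduced_ereduce formula.abs_eq_iff expr_eq_ereduce)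
  then show ?thesis by blast
qed

lemma ereduce_EAnd:
  "ereduce (EAnd a b) = EZero \<longleftrightarrow> ereduce a = EZero \<or> ereduce b = EZero"
  "ereduce (EAnd a b) = EOne \<longleftrightarrow> ereduce a = EOne \<and> ereduce b = EOne"
  "evars (ereduce (EAnd a b)) =
    (if ereduce a = EZero \<or> ereduce b = EZero then {} else evars (ereduce a) \<union> evars (ereduce b))"
  by auto

lemma ereduce_EOr:
  "ereduce (EOr a b) = EZero \<longleftrightarrow> ereduce a = EZero \<and> ereduce b = EZero"
  "ereduce (EOr a b) = EOne \<longleftrightarrow> ereduce a = EOne \<or> ereduce b = EOne"
  "evars (ereduce (EOr a b)) =
    (if ereduce a = EOne \<or> ereduce b = EOne then {} else evars (ereduce a) \<union> evars (ereduce b))"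
  by auto

lemma evars_ereduce_cong:
  assumes "expr_eq a b"
  shows "evars (ereduce a) = evars (ereduce b) \<and>
    (ereduce a = EZero \<longleftrightarrow> ereduce b = EZero) \<and> (ereduce a = EOne \<longleftrightarrow> ereduce b = EOne)"
  using assms
  by induction
    (simp_all add: ereduce_EAnd ereduce_EOr Un_ac conj_ac disj_ac del: ereduce.simps(5,6))

lemma vars_eq_evars:
  assumes "a \<in> exprs F"
  shows "vars F = evars a"
proof -
  have "evars b = evars a" if "b \<in> exprs F" for b
  proof -
    have "abs_formula b = abs_formula a"
      using assms that by (simp add: exprs_def)
    then have *: "expr_eq b a"
      by (rule formula.abs_eq_iff[THEN iffD1])
    then show ?thesis
      using evars_ereduce_cong[OF *] assms that ereduce_id[of a] ereduce_id[of b]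
      unfolding exprs_def by simp
  qed
  then show ?thesis
    using assms unfolding vars_def by blast
qed

lemma finite_vars: "finite (vars F)"
proof -
  obtain a where "a \<in> exprs F"
    using exprs_nonempty by blast
  moreover have "finite (evars a)"
    by (induction a) auto
  ultimately show ?thesis
    by (simp add: vars_eq_evars)
qed

definition closed_under_subformulas :: "'v formula set \<Rightarrow> bool" where
  "closed_under_subformulas \<C> \<longleftrightarrow> (\<forall>F \<in> \<C>. subformulas F \<subseteq> \<C>)"

definition closed_under_compl :: "'v formula set \<Rightarrow> bool" where
  "closed_under_compl \<C> \<longleftrightarrow> (\<forall>F \<in> \<C>. compl F \<in> \<C>)"

text \<open>Closure under binary disjunction; in particular \<open>Zero\<close> is not added.\<close>

inductive_set disj_closure :: "'v formula set \<Rightarrow> 'v formula set" for \<C> where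
  base: "F \<in> \<C> \<Longrightarrow> F \<in> disj_closure \<C>"
| disj: "F \<in> disj_closure \<C> \<Longrightarrow> G \<in> disj_closure \<C> \<Longrightarrow> F \<^bold>\<or> G \<in> disj_closure \<C>"

definition entails :: "'v formula set \<Rightarrow> 'v formula \<Rightarrow> bool" where
  "entails \<Gamma> A \<longleftrightarrow> (\<forall>\<alpha>. (\<forall>B \<in> \<Gamma>. holds \<alpha> B) \<longrightarrow> holds \<alpha> A)"

text \<open>\<open>frege_rule H G\<close>: the formula \<open>G\<close> is inferred from the premises \<open>H\<close> in one step.
  The metavariables range over all formulas, including the constants.\<close>

inductive frege_rule :: "'v formula set \<Rightarrow> 'v formula \<Rightarrow> bool" where
  axiom: "frege_rule {} (A \<^bold>\<or> compl A)"
| cut: "frege_rule {C \<^bold>\<or> A, D \<^bold>\<or> compl A} (C \<^bold>\<or> D)"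
| conj_intro: "frege_rule {C \<^bold>\<or> A, D \<^bold>\<or> B} (C \<^bold>\<or> D \<^bold>\<or> (A \<^bold>\<and> B))"
| weakening: "frege_rule {C} (C \<^bold>\<or> D)"

definition frege_proof :: "'v formula set \<Rightarrow> 'v formula \<Rightarrow> 'v formula list \<Rightarrow> bool" where
  "frege_proof \<Gamma> A P \<longleftrightarrow> P \<noteq> [] \<and> last P = A \<and>
     (\<forall>i < length P. P ! i \<in> \<Gamma> \<or> (\<exists>H \<subseteq> set (take i P). frege_rule H (P ! i)))"

definition class_frege_proof ::
    "'v formula set \<Rightarrow> 'v formula set \<Rightarrow> 'v formula \<Rightarrow> 'v formula list \<Rightarrow> bool" where
  "class_frege_proof \<D> \<Gamma> A P \<longleftrightarrow> frege_proof \<Gamma> A P \<and> set P \<subseteq> \<D>"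

definition proof_size :: "'v formula list \<Rightarrow> nat" where
  "proof_size P = (\<Sum>F \<leftarrow> P. fsize F)"

text \<open>Polynomial functions of five arguments, as finite sums of monomials; for upper bounds on
  natural numbers it is no restriction that the coefficients are natural numbers.\<close>

definition polynomial5 :: "(nat \<Rightarrow> nat \<Rightarrow> nat \<Rightarrow> nat \<Rightarrow> nat \<Rightarrow> nat) \<Rightarrow> bool" where
  "polynomial5 p \<longleftrightarrow> (\<exists>monomials.
     p = (\<lambda>x\<^sub>1 x\<^sub>2 x\<^sub>3 x\<^sub>4 x\<^sub>5. \<Sum>(c, i, j, k, l, r) \<leftarrow> monomials. c * x\<^sub>1 ^ i * x\<^sub>2 ^ j * x\<^sub>3 ^ k * x\<^sub>4 ^ l * x\<^sub>5 ^ r))"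

end

(* Let x1, ..., xn be the variables that occur. For an assignment \<alpha> let L be the disjunction of the n
   literals that \<alpha> falsifies, and G = L \<or> A. Every formula F of \<C> has, by induction on F, a proof of
   G \<or> F or of G \<or> \<not>F, according to its value under \<alpha>. A formula of the closure \<C>' is a disjunction of
   formulas of \<C> that can be read off any of its expressions. If \<alpha> satisfies A, then it satisfies one
   of the disjuncts F of A, and G \<or> F is just G. Otherwise \<alpha> falsifies all disjuncts of some A_i, and
   cutting them away one after the other from G \<or> A_i leaves G. Finally the n variables are cut
   away from the 2^n formulas L \<or> A. Nothing has to be enumerated over choices of disjuncts, so the
   quantity s^m does not occur in the bound obtained. *)

theory Submission
  imports Defs "HOL-Library.Sublist"
begin

section \<open>Formulas and their expressions\<close>

lemma Disj_left_commute: "A \<^bold>\<or> (B \<^bold>\<or> D) = B \<^bold>\<or> (A \<^bold>\<or> D)"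
  by (metis Disj_assoc Disj_commute)

lemma Disj_left_idem: "A \<^bold>\<or> (A \<^bold>\<or> B) = A \<^bold>\<or> B"
  by (metis Disj_assoc Disj_idem)

lemmas Disj_ac = Disj_assoc Disj_commute Disj_left_commute Disj_left_idem

lemma abs_formula_simps:
  "abs_formula EZero = Zero" "abs_formula EOne = One"
  "abs_formula (EPos x) = Pos x" "abs_formula (ENeg x) = Neg x"
  "abs_formula (EAnd a b) = abs_formula a \<^bold>\<and> abs_formula b"
  "abs_formula (EOr a b) = abs_formula a \<^bold>\<or> abs_formula b"
  by (simp_all add: Zero.abs_eq One.abs_eq Pos.abs_eq Neg.abs_eq Conj.abs_eq Disj.abs_eq)

lemma holds_simps:
  "holds \<alpha> (A \<^bold>\<or> B) \<longleftrightarrow> holds \<alpha> A \<or> holds \<alpha> B"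
  "\<not> holds \<alpha> Zero"
  "holds \<alpha> (abs_formula a) \<longleftrightarrow> eeval \<alpha> a"
  by (transfer, simp)+

lemma abs_formula_ereduce: "abs_formula (ereduce a) = abs_formula a"
  by (simp add: formula.abs_eq_iff expr_eq_ereduce)

text \<open>The minimum in \<open>fsize\<close> ranges over reduced expressions only, but
  \<open>ereduce\<close> never increases \<open>esize\<close>. Sizes can therefore be bounded by any
  expression at hand, even one with constants inside.\<close>

lemma fsize_abs_formula: "fsize (abs_formula a) \<le> esize a"
proof -
  have "ereduce a \<in> exprs (abs_formula a)"
    by (simp add: exprs_def reduced_ereduce abs_formula_ereduce)
  then have "fsize (abs_formula a) \<le> esize (ereduce a)"
    unfolding fsize_def by (intro Least_le) blast
  also have "\<dots> \<le> esize a"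
    by (induction a) auto
  finally show ?thesis .
qed

lemma shortest_expr:
  obtains a where "a \<in> exprs F" "esize a = fsize F"
proof -
  have "\<exists>k. \<exists>a \<in> exprs F. esize a = k"
    using exprs_nonempty by blast
  from LeastI_ex[OF this] show ?thesis
    using that unfolding fsize_def by blast
qed

lemma fsize_Disj: "fsize (F \<^bold>\<or> G) \<le> fsize F + fsize G + 1"
proof -
  obtain a b where "a \<in> exprs F" "esize a = fsize F" "b \<in> exprs G" "esize b = fsize G"
    by (metis shortest_expr)
  then show ?thesis
    using fsize_abs_formula[of "EOr a b"] by (simp add: exprs_def abs_formula_simps)
qed

lemma fsize_compl: "fsize (compl F) \<le> fsize F"
proof -
  obtain a where a: "a \<in> exprs F" "esize a = fsize F"
    by (rule shortest_expr)
  have "esize (eneg a) = esize a"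
    by (induction a) auto
  then show ?thesis
    using a fsize_abs_formula[of "eneg a"] by (auto simp: exprs_def compl.abs_eq)
qed

lemma self_in_esubs: "a \<in> esubs a"
  by (cases a) auto

lemma esize_esubs: "b \<in> esubs a \<Longrightarrow> esize b \<le> esize a"
  by (induction a) auto

lemma evars_esubs: "x \<in> evars a \<Longrightarrow> EPos x \<in> esubs a \<or> ENeg x \<in> esubs a"
  by (induction a) auto

text \<open>\<open>subformulas\<close> collects over all reduced expressions of a formula, so any of
  them may be chosen, a shortest one included.\<close>

lemma abs_esubs_closed:
  assumes "closed_under_subformulas \<C>" "reduced a" "abs_formula a \<in> \<C>"
  shows "abs_formula ` esubs a \<subseteq> \<C>"
  using assms unfolding closed_under_subformulas_def subformulas_def exprs_def by blast

section \<open>Disjunctions of lists\<close>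

text \<open>The fold ends in a formula \<open>G\<close> instead of \<open>Zero\<close>, since
  \<open>Zero\<close> need not lie in \<open>disj_closure \<C>\<close>.\<close>

abbreviation disjs :: "'v formula list \<Rightarrow> 'v formula \<Rightarrow> 'v formula" where
  "disjs Fs G \<equiv> foldr Disj Fs G"

lemma disjs_absorb_base: "G \<^bold>\<or> disjs Fs G = disjs Fs G"
  by (induction Fs) (simp_all add: Disj_left_commute[of G])

text \<open>Idempotence of disjunction. This turns a derivation of \<open>G \<or> F\<close> into one
  of \<open>G\<close> whenever \<open>F\<close> is already a disjunct of \<open>G\<close>.\<close>

lemma disjs_absorb: "F \<in> set Fs \<Longrightarrow> F \<^bold>\<or> disjs Fs G = disjs Fs G"
  by (induction Fs) (auto simp: Disj_left_idem Disj_left_commute[of F])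

lemma holds_disjs: "holds \<alpha> (disjs Fs G) \<longleftrightarrow> (\<exists>F \<in> set Fs. holds \<alpha> F) \<or> holds \<alpha> G"
  by (induction Fs) (auto simp: holds_simps)

lemma fsize_disjs:
  "(\<And>F. F \<in> set Fs \<Longrightarrow> fsize F \<le> k) \<Longrightarrow> fsize (disjs Fs G) \<le> length Fs * (k + 1) + fsize G"
proof (induction Fs)
  case (Cons F Fs)
  then have "fsize F \<le> k" "fsize (disjs Fs G) \<le> length Fs * (k + 1) + fsize G"
    by auto
  then show ?case
    using fsize_Disj[of F "disjs Fs G"] by simp
qed simp

lemma disjs_in_disj_closure:
  "set Fs \<subseteq> disj_closure \<C> \<Longrightarrow> G \<in> disj_closure \<C> \<Longrightarrow> disjs Fs G \<in> disj_closure \<C>"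
  by (induction Fs) (auto intro: disj_closure.disj)

section \<open>Expressions of formulas in the disjunctive closure\<close>

text \<open>Because of \<open>A \<^bold>\<and> A = A\<close>, an expression of a formula in the disjunctive closure need not
  be a disjunction of expressions of formulas in \<open>\<C>\<close>; the second alternative for
  conjunctions makes the predicate invariant under this law.\<close>

primrec splits_in :: "'v formula set \<Rightarrow> 'v expr \<Rightarrow> bool" where
  "splits_in \<C> EZero \<longleftrightarrow> Zero \<in> \<C>"
| "splits_in \<C> EOne \<longleftrightarrow> One \<in> \<C>"
| "splits_in \<C> (EPos x) \<longleftrightarrow> Pos x \<in> \<C>"
| "splits_in \<C> (ENeg x) \<longleftrightarrow> Neg x \<in> \<C>"
| "splits_in \<C> (EAnd a b) \<longleftrightarrow> abs_formula (EAnd a b) \<in> \<C> \<or>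
     (abs_formula a = abs_formula b \<and> splits_in \<C> a \<and> splits_in \<C> b)"
| "splits_in \<C> (EOr a b) \<longleftrightarrow> splits_in \<C> a \<and> splits_in \<C> b"

lemma splits_in_of_subs: "abs_formula ` esubs a \<subseteq> \<C> \<Longrightarrow> splits_in \<C> a"
  by (induction a) (auto simp: abs_formula_simps)

lemma splits_in_base:
  assumes "closed_under_subformulas \<C>" "abs_formula a \<in> \<C>"
  shows "splits_in \<C> (ereduce a)"
  using abs_esubs_closed[OF assms(1) reduced_ereduce] assms(2)
  by (intro splits_in_of_subs) (simp add: abs_formula_ereduce)

text \<open>Induction over the laws generating \<open>expr_eq\<close>. Both sides are reduced first
  because a law such as \<open>EAnd EZero a = EZero\<close> discards an arbitrary \<open>a\<close>,
  about which \<open>splits_in\<close> could say anything.\<close>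

lemma splits_in_expr_eq:
  assumes closed: "closed_under_subformulas \<C>" and "expr_eq a b"
  shows "splits_in \<C> (ereduce a) \<longleftrightarrow> splits_in \<C> (ereduce b)"
  using assms(2)
proof induction
  case (and_cong a a' b b')
  then have "abs_formula a = abs_formula a'" "abs_formula b = abs_formula b'"
    by (simp_all add: formula.abs_eq_iff)
  then show ?case
    \<comment> \<open>What matters here is not the variables but the agreement on being
      \<open>EZero\<close> or \<open>EOne\<close>: it makes \<open>ereduce\<close> take the same
      branch on both sides.\<close>
    using and_cong evars_ereduce_cong[of a a'] evars_ereduce_cong[of b b']
    by (auto simp: abs_formula_simps abs_formula_ereduce)
next
  case (or_cong a a' b b')
  then show ?case
    using evars_ereduce_cong[of a a'] evars_ereduce_cong[of b b'] by auto
next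
  case (and_comm a b)
  then show ?case
    by (auto simp: abs_formula_simps abs_formula_ereduce Conj_commute)
next
  case (and_assoc a b c)
  \<comment> \<open>A form common to both bracketings. If one inner conjunction is in
    \<open>\<C>\<close> and equals the third conjunct, then by idempotence the whole conjunction is
    in \<open>\<C>\<close> too.\<close>
  let ?all = "\<lambda>a b c. abs_formula a \<^bold>\<and> abs_formula b \<^bold>\<and> abs_formula c \<in> \<C> \<or>
    (abs_formula a = abs_formula b \<and> abs_formula b = abs_formula c \<and>
     splits_in \<C> a \<and> splits_in \<C> b \<and> splits_in \<C> c)"
  have "splits_in \<C> (EAnd (EAnd a b) c) \<longleftrightarrow> ?all a b c" for a b c
    unfolding splits_in.simps abs_formula_simps by (metis Conj_assoc Conj_idem)
  moreover have "splits_in \<C> (EAnd a (EAnd b c)) \<longleftrightarrow> ?all a b c" for a b c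
    unfolding splits_in.simps abs_formula_simps by (metis Conj_idem)
  ultimately show ?case
    by (simp del: splits_in.simps)
next
  \<comment> \<open>Only this law needs closure under subformulas: if the conjunction of
    \<open>a\<close> with itself is in \<open>\<C>\<close>, so is the formula of \<open>a\<close>,
    and then \<open>a\<close> splits by \<open>splits_in_base\<close>.\<close>
  case (and_idem a)
  then show ?case
    using splits_in_base[OF closed, of a] by (auto simp: abs_formula_simps abs_formula_ereduce)
qed auto

text \<open>The way a formula was built as a disjunction provides one expression that splits;
  invariance under \<open>expr_eq\<close> carries this over to every reduced expression, in
  particular to a shortest one.\<close>

lemma splits_in_disj_closure:
  assumes closed: "closed_under_subformulas \<C>" and "F \<in> disj_closure \<C>" "a \<in> exprs F"
  shows "splits_in \<C> a"
  using assms(2,3)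
proof (induction arbitrary: a)
  case (base F)
  then show ?case
    using splits_in_base[OF closed, of a] by (simp add: exprs_def ereduce_id)
next
  case (disj F G)
  obtain f g where fg: "f \<in> exprs F" "g \<in> exprs G"
    using exprs_nonempty by blast
  then have "splits_in \<C> f" "splits_in \<C> g" "ereduce f = f" "ereduce g = g"
    using disj.IH by (auto simp: exprs_def ereduce_id)
  then have "splits_in \<C> (ereduce (EOr f g))"
    by auto
  moreover have "expr_eq (EOr f g) a"
    using fg disj.prems by (simp add: exprs_def abs_formula_simps flip: formula.abs_eq_iff)
  ultimately show ?case
    using splits_in_expr_eq[OF closed, of "EOr f g" a] disj.prems
    by (simp add: exprs_def ereduce_id del: ereduce.simps)
qed

text \<open>Some literal of \<open>x\<close> occurs below a part that lies in \<open>\<C>\<close>;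
  complementation supplies the opposite literal.\<close>

lemma splits_in_evars:
  assumes closed: "closed_under_subformulas \<C>" "closed_under_compl \<C>"
  shows "reduced a \<Longrightarrow> splits_in \<C> a \<Longrightarrow> x \<in> evars a \<Longrightarrow> Pos x \<in> \<C> \<and> Neg x \<in> \<C>"
proof (induction a)
  case (EAnd a b)
  show ?case
  proof (cases "abs_formula (EAnd a b) \<in> \<C>")
    case True
    then have "abs_formula (EPos x) \<in> \<C> \<or> abs_formula (ENeg x) \<in> \<C>"
      using abs_esubs_closed[OF closed(1) EAnd.prems(1)] evars_esubs[OF EAnd.prems(3)] by blast
    then show ?thesis
      using closed(2) unfolding closed_under_compl_def
      by (metis abs_formula_simps(3,4) compl_simps(3,4))
  next
    case False
    then show ?thesis
      using EAnd by (auto simp: reduced_def)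
  qed
qed (use closed(2) in \<open>force simp: closed_under_compl_def reduced_def\<close>)+

text \<open>The \<open>+ 1\<close> accounts for constants, which have size 0 but form one part; at a
  disjunction the two bounds add up exactly.\<close>

lemma splits_in_parts:
  "reduced a \<Longrightarrow> splits_in \<C> a \<Longrightarrow> \<exists>bs. length bs \<le> esize a + 1 \<and>
    (\<forall>b \<in> set bs. reduced b \<and> abs_formula b \<in> \<C> \<and> esize b \<le> esize a \<and> evars b \<subseteq> evars a) \<and>
    (\<forall>G. abs_formula a \<^bold>\<or> G = disjs (map abs_formula bs) G)"
proof (induction a)
  case (EOr a b)
  then have prems: "reduced a" "splits_in \<C> a" "reduced b" "splits_in \<C> b"
    by (auto simp: reduced_def)
  obtain bs where bs: "length bs \<le> esize a + 1"
    "\<forall>c \<in> set bs. reduced c \<and> abs_formula c \<in> \<C> \<and> esize c \<le> esize a \<and> evars c \<subseteq> evars a"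
    "\<forall>G. abs_formula a \<^bold>\<or> G = disjs (map abs_formula bs) G"
    using EOr.IH(1)[OF prems(1,2)] by blast
  obtain cs where cs: "length cs \<le> esize b + 1"
    "\<forall>c \<in> set cs. reduced c \<and> abs_formula c \<in> \<C> \<and> esize c \<le> esize b \<and> evars c \<subseteq> evars b"
    "\<forall>G. abs_formula b \<^bold>\<or> G = disjs (map abs_formula cs) G"
    using EOr.IH(2)[OF prems(3,4)] by blast
  have "abs_formula (EOr a b) \<^bold>\<or> G = disjs (map abs_formula (bs @ cs)) G" for G
    unfolding abs_formula_simps Disj_assoc using bs(3) cs(3) by simp
  moreover have "length (bs @ cs) \<le> esize (EOr a b) + 1"
    using bs(1) cs(1) by simp
  moreover have "\<forall>c \<in> set (bs @ cs). reduced c \<and> abs_formula c \<in> \<C> \<and>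
      esize c \<le> esize (EOr a b) \<and> evars c \<subseteq> evars (EOr a b)"
    using bs(2) cs(2) by (auto simp: trans_le_add1 trans_le_add2 le_Suc_eq)
  ultimately show ?case
    by blast
next
  case (EAnd a b)
  show ?case
  proof (cases "abs_formula (EAnd a b) \<in> \<C>")
    case True
    then show ?thesis
      using EAnd.prems by (intro exI[of _ "[EAnd a b]"]) simp
  next
    case False
    then have eq: "abs_formula a = abs_formula b" and prems: "reduced a" "splits_in \<C> a"
      using EAnd.prems by (auto simp: reduced_def)
    obtain bs where bs: "length bs \<le> esize a + 1"
      "\<forall>c \<in> set bs. reduced c \<and> abs_formula c \<in> \<C> \<and> esize c \<le> esize a \<and> evars c \<subseteq> evars a"
      "\<forall>G. abs_formula a \<^bold>\<or> G = disjs (map abs_formula bs) G"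
      using EAnd.IH(1)[OF prems] by blast
    \<comment> \<open>Both conjuncts are the same formula, so the parts of \<open>a\<close> alone
      represent the conjunction.\<close>
    have "abs_formula (EAnd a b) \<^bold>\<or> G = disjs (map abs_formula bs) G" for G
      using bs(3) by (simp add: abs_formula_simps flip: eq)
    moreover have "\<forall>c \<in> set bs. reduced c \<and> abs_formula c \<in> \<C> \<and>
        esize c \<le> esize (EAnd a b) \<and> evars c \<subseteq> evars (EAnd a b)"
      using bs(2) by (auto simp: trans_le_add1 le_Suc_eq)
    moreover have "length bs \<le> esize (EAnd a b) + 1"
      using bs(1) by simp
    ultimately show ?thesis
      by blast
  qed
next
  case EZero
  then show ?case
    by (intro exI[of _ "[EZero]"]) (simp add: abs_formula_simps)
next
  case EOne
  then show ?case
    by (intro exI[of _ "[EOne]"]) (simp add: abs_formula_simps)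
next
  case (EPos x)
  then show ?case
    by (intro exI[of _ "[EPos x]"]) (simp add: abs_formula_simps)
next
  case (ENeg x)
  then show ?case
    by (intro exI[of _ "[ENeg x]"]) (simp add: abs_formula_simps)
qed

lemma disj_closure_parts:
  assumes "closed_under_subformulas \<C>" "F \<in> disj_closure \<C>" "fsize F \<le> s"
  obtains bs where "length bs \<le> s + 1"
    "\<And>b. b \<in> set bs \<Longrightarrow> abs_formula ` esubs b \<subseteq> \<C>"
    "\<And>b. b \<in> set bs \<Longrightarrow> esize b \<le> s"
    "\<And>b. b \<in> set bs \<Longrightarrow> evars b \<subseteq> vars F"
    "\<And>G. F \<^bold>\<or> G = disjs (map abs_formula bs) G"
    "\<And>\<alpha>. holds \<alpha> F \<longleftrightarrow> (\<exists>b \<in> set bs. eeval \<alpha> b)"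
proof -
  obtain a where a: "a \<in> exprs F" "esize a = fsize F"
    by (rule shortest_expr)
  then have F: "reduced a" "abs_formula a = F" "vars F = evars a"
    by (auto simp: exprs_def vars_eq_evars[OF a(1)])
  obtain bs where bs: "length bs \<le> esize a + 1"
    "\<And>b. b \<in> set bs \<Longrightarrow> reduced b \<and> abs_formula b \<in> \<C> \<and> esize b \<le> esize a \<and> evars b \<subseteq> evars a"
    "\<And>G. abs_formula a \<^bold>\<or> G = disjs (map abs_formula bs) G"
    using splits_in_parts[OF F(1) splits_in_disj_closure[OF assms(1,2) a(1)]] by blast
  \<comment> \<open>With base \<open>Zero\<close>, which is false, the decomposition determines the
    truth value of \<open>F\<close>; no membership in the class is at stake here.\<close>
  have "holds \<alpha> F \<longleftrightarrow> (\<exists>b \<in> set bs. eeval \<alpha> b)" for \<alpha>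
    using arg_cong[OF bs(3)[of Zero], of "holds \<alpha>"]
    by (auto simp: holds_simps holds_disjs F(2)[symmetric])
  then show thesis
    using bs F a(2) assms(3) abs_esubs_closed[OF assms(1)]
    by (intro that[of bs]) (auto intro: order_trans)
qed

section \<open>Frege derivations of bounded length\<close>

text \<open>Only lines are counted. A size bound for the single formulas is put into
  \<open>\<D>\<close> later, and the product of the two bounds the size of the proof.\<close>

definition derivable :: "'v formula set \<Rightarrow> 'v formula set \<Rightarrow> nat \<Rightarrow> 'v formula \<Rightarrow> bool" where
  "derivable \<D> \<Gamma> k F \<longleftrightarrow> (\<exists>P. class_frege_proof \<D> \<Gamma> F P \<and> length P \<le> k)"

lemma derivable_mono: "derivable \<D> \<Gamma> k F \<Longrightarrow> k \<le> l \<Longrightarrow> derivable \<D> \<Gamma> l F"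
  unfolding derivable_def using order_trans by blast

text \<open>The local condition of \<open>frege_proof\<close> without a conclusion, so that it also
  covers the empty list and is preserved by concatenation.\<close>

definition inferences :: "'v formula set \<Rightarrow> 'v formula list \<Rightarrow> bool" where
  "inferences \<Gamma> P \<longleftrightarrow>
     (\<forall>i < length P. P ! i \<in> \<Gamma> \<or> (\<exists>H \<subseteq> set (take i P). frege_rule H (P ! i)))"

lemma inferences_snoc:
  "inferences \<Gamma> (P @ [F]) \<longleftrightarrow> inferences \<Gamma> P \<and> (F \<in> \<Gamma> \<or> (\<exists>H \<subseteq> set P. frege_rule H F))"
  unfolding inferences_def by (auto simp: less_Suc_eq nth_append)

lemma inferences_append: "inferences \<Gamma> P \<Longrightarrow> inferences \<Gamma> Q \<Longrightarrow> inferences \<Gamma> (P @ Q)"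
proof (induction Q rule: rev_induct)
  case (snoc F Q)
  then show ?case
    by (simp add: inferences_snoc flip: append_assoc) blast
qed simp

lemma derivable_altdef:
  "derivable \<D> \<Gamma> k F \<longleftrightarrow>
     (\<exists>P. inferences \<Gamma> P \<and> P \<noteq> [] \<and> last P = F \<and> set P \<subseteq> \<D> \<and> length P \<le> k)"
  by (auto simp: derivable_def class_frege_proof_def frege_proof_def inferences_def)

lemma derivable_snoc:
  assumes "inferences \<Gamma> P" "set P \<subseteq> \<D>" "F \<in> \<D>" "length P < k"
    "F \<in> \<Gamma> \<or> (\<exists>H \<subseteq> set P. frege_rule H F)"
  shows "derivable \<D> \<Gamma> k F"
  unfolding derivable_altdef using assms
  by (intro exI[of _ "P @ [F]"]) (simp add: inferences_snoc)

lemma derivable_hyp: "F \<in> \<Gamma> \<Longrightarrow> F \<in> \<D> \<Longrightarrow> derivable \<D> \<Gamma> 1 F"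
  by (rule derivable_snoc[of _ "[]"]) (auto simp: inferences_def)

lemma derivable_axiom: "A \<^bold>\<or> compl A \<in> \<D> \<Longrightarrow> derivable \<D> \<Gamma> 1 (A \<^bold>\<or> compl A)"
  by (rule derivable_snoc[of _ "[]"]) (auto simp: inferences_def intro: frege_rule.axiom)

lemma derivable_weakening:
  assumes "derivable \<D> \<Gamma> k F" "F \<^bold>\<or> G \<in> \<D>"
  shows "derivable \<D> \<Gamma> (k + 1) (F \<^bold>\<or> G)"
proof -
  obtain P where P: "inferences \<Gamma> P" "P \<noteq> []" "last P = F" "set P \<subseteq> \<D>" "length P \<le> k"
    using assms(1) unfolding derivable_altdef by blast
  then have "{F} \<subseteq> set P"
    using last_in_set by blast
  then have "\<exists>H \<subseteq> set P. frege_rule H (F \<^bold>\<or> G)"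
    using frege_rule.weakening by blast
  then show ?thesis
    using P assms(2) by (intro derivable_snoc[of _ P]) auto
qed

text \<open>The two proofs are concatenated and the conclusion is appended, whence the sum plus
  one.\<close>

lemma derivable_binary:
  assumes "derivable \<D> \<Gamma> k E" "derivable \<D> \<Gamma> l F" "frege_rule {E, F} G" "G \<in> \<D>"
  shows "derivable \<D> \<Gamma> (k + l + 1) G"
proof -
  obtain P where P: "inferences \<Gamma> P" "P \<noteq> []" "last P = E" "set P \<subseteq> \<D>" "length P \<le> k"
    using assms(1) unfolding derivable_altdef by blast
  obtain Q where Q: "inferences \<Gamma> Q" "Q \<noteq> []" "last Q = F" "set Q \<subseteq> \<D>" "length Q \<le> l"
    using assms(2) unfolding derivable_altdef by blast
  have "{E, F} \<subseteq> set (P @ Q)"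
    using P(2,3) Q(2,3) last_in_set by fastforce
  then show ?thesis
    using P Q assms(3,4) inferences_append[OF P(1) Q(1)]
    by (intro derivable_snoc[of _ "P @ Q"]) auto
qed

lemma derivable_cut:
  assumes "derivable \<D> \<Gamma> k (C \<^bold>\<or> A)" "derivable \<D> \<Gamma> l (D \<^bold>\<or> compl A)" "C \<^bold>\<or> D \<in> \<D>"
  shows "derivable \<D> \<Gamma> (k + l + 1) (C \<^bold>\<or> D)"
  using derivable_binary[OF assms(1,2) frege_rule.cut assms(3)] .

lemma derivable_conj:
  assumes "derivable \<D> \<Gamma> k (C \<^bold>\<or> A)" "derivable \<D> \<Gamma> l (C \<^bold>\<or> B)" "C \<^bold>\<or> (A \<^bold>\<and> B) \<in> \<D>"
  shows "derivable \<D> \<Gamma> (k + l + 1) (C \<^bold>\<or> (A \<^bold>\<and> B))"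
  using derivable_binary[OF assms(1,2), of "C \<^bold>\<or> (A \<^bold>\<and> B)"] frege_rule.conj_intro[of C A C B] assms(3)
  by (simp add: Disj_left_idem)

text \<open>Each cut removes the first disjunct, and the extra copy of \<open>G\<close> it
  introduces is absorbed by the base. Hence the intermediate lines are the disjunctions over
  suffixes.\<close>

lemma derivable_cut_disjs:
  assumes "derivable \<D> \<Gamma> k (disjs Fs G)"
    and "\<And>F. F \<in> set Fs \<Longrightarrow> derivable \<D> \<Gamma> l (G \<^bold>\<or> compl F)"
    and "\<And>Es. suffix Es Fs \<Longrightarrow> disjs Es G \<in> \<D>"
  shows "derivable \<D> \<Gamma> (k + length Fs * (l + 1)) G"
  using assms
proof (induction Fs arbitrary: k)
  case (Cons F Fs)
  have "derivable \<D> \<Gamma> (k + l + 1) (disjs Fs G \<^bold>\<or> G)"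
    by (rule derivable_cut[of _ _ _ _ F])
      (use Cons.prems Cons.prems(3)[of Fs] in \<open>simp_all add: Disj_commute disjs_absorb_base suffix_Cons\<close>)
  then have "derivable \<D> \<Gamma> (k + l + 1) (disjs Fs G)"
    by (simp add: Disj_commute disjs_absorb_base)
  then have "derivable \<D> \<Gamma> ((k + l + 1) + length Fs * (l + 1)) G"
    using Cons.prems by (intro Cons.IH) (auto simp: suffix_Cons)
  then show ?case
    by (simp add: ac_simps)
qed simp

section \<open>Evaluating formulas under an assignment\<close>

text \<open>The disjunction of these literals over a set of variables is false exactly under the
  assignments that agree with \<open>\<alpha>\<close> there.\<close>

definition false_lit :: "('v \<Rightarrow> bool) \<Rightarrow> 'v \<Rightarrow> 'v formula" where
  "false_lit \<alpha> x = (if \<alpha> x then Neg x else Pos x)"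

text \<open>The side formula \<open>G\<close> absorbs the literals false under
  \<open>\<alpha>\<close>, so it encodes the assumption that the assignment is
  \<open>\<alpha>\<close>. The bound is chosen so that two derivations and one conjunction line fit:
  \<open>(3 * a + 2) + (3 * b + 2) + 1 = 3 * (a + b + 1) + 2\<close>.\<close>

lemma derivable_value:
  assumes "\<And>c. c \<in> esubs b \<Longrightarrow> G \<^bold>\<or> abs_formula c \<in> \<D> \<and> G \<^bold>\<or> compl (abs_formula c) \<in> \<D>"
    and "\<And>x. x \<in> evars b \<Longrightarrow> Pos x \<^bold>\<or> Neg x \<in> \<D>"
    and "\<And>x. x \<in> evars b \<Longrightarrow> false_lit \<alpha> x \<^bold>\<or> G = G"
  shows "derivable \<D> \<Gamma> (3 * esize b + 2)
    (G \<^bold>\<or> (if eeval \<alpha> b then abs_formula b else compl (abs_formula b)))"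
  using assms
proof (induction b)
  case EZero
  \<comment> \<open>The target \<open>G \<or> One\<close> is \<open>One\<close>, which is itself the
    axiom for \<open>One\<close>.\<close>
  then show ?case
    using derivable_axiom[of One \<D> \<Gamma>, THEN derivable_mono, of 2]
    by (simp add: abs_formula_simps Disj_commute[of G] flip: numeral_2_eq_2)
next
  case EOne
  then show ?case
    using derivable_axiom[of One \<D> \<Gamma>, THEN derivable_mono, of 2]
    by (simp add: abs_formula_simps Disj_commute[of G] flip: numeral_2_eq_2)
next
  case (EPos x)
  \<comment> \<open>The false literal is already in \<open>G\<close>, so adding the true one amounts
    to weakening an excluded middle by \<open>G\<close>.\<close>
  have eq: "G \<^bold>\<or> (if \<alpha> x then Pos x else Neg x) = (Pos x \<^bold>\<or> compl (Pos x)) \<^bold>\<or> G"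
    using EPos(3)[of x] by (auto simp: false_lit_def) (metis Disj_ac)+
  have "derivable \<D> \<Gamma> (1 + 1) ((Pos x \<^bold>\<or> compl (Pos x)) \<^bold>\<or> G)"
    using EPos(1)[of "EPos x"] EPos(2)[of x] eq
    by (intro derivable_weakening derivable_axiom) (auto simp: abs_formula_simps split: if_splits)
  then show ?case
    unfolding eq[symmetric] by (auto simp: abs_formula_simps elim!: derivable_mono)
next
  case (ENeg x)
  have eq: "G \<^bold>\<or> (if \<alpha> x then Pos x else Neg x) = (Pos x \<^bold>\<or> compl (Pos x)) \<^bold>\<or> G"
    using ENeg(3)[of x] by (auto simp: false_lit_def) (metis Disj_ac)+
  have "derivable \<D> \<Gamma> (1 + 1) ((Pos x \<^bold>\<or> compl (Pos x)) \<^bold>\<or> G)"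
    using ENeg(1)[of "ENeg x"] ENeg(2)[of x] eq
    by (intro derivable_weakening derivable_axiom) (auto simp: abs_formula_simps split: if_splits)
  then show ?case
    unfolding eq[symmetric] by (auto simp: abs_formula_simps elim!: derivable_mono)
next
  case (EAnd a b)
  let ?v = "\<lambda>c. if eeval \<alpha> c then abs_formula c else compl (abs_formula c)"
  have IH: "derivable \<D> \<Gamma> (3 * esize a + 2) (G \<^bold>\<or> ?v a)"
    "derivable \<D> \<Gamma> (3 * esize b + 2) (G \<^bold>\<or> ?v b)"
    using EAnd by simp_all
  have D: "G \<^bold>\<or> (abs_formula a \<^bold>\<and> abs_formula b) \<in> \<D>"
    "G \<^bold>\<or> (compl (abs_formula a) \<^bold>\<or> compl (abs_formula b)) \<in> \<D>"
    using EAnd.prems(1)[of "EAnd a b"] by (simp_all add: abs_formula_simps)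
  consider "eeval \<alpha> a" "eeval \<alpha> b" | "\<not> eeval \<alpha> a" | "\<not> eeval \<alpha> b"
    by blast
  then show ?case
  proof cases
    case 1
    then show ?thesis
      using derivable_conj[of \<D> \<Gamma> _ G, OF _ _ D(1)] IH
      by (simp add: abs_formula_simps) (fastforce elim: derivable_mono)
  next
    case 2
    then show ?thesis
      using derivable_weakening[OF IH(1), of "compl (abs_formula b)"] D(2)
      by (auto simp: abs_formula_simps Disj_assoc elim!: derivable_mono)
  next
    case 3
    then show ?thesis
      using derivable_weakening[OF IH(2), of "compl (abs_formula a)"] D(2)
      by (auto simp: abs_formula_simps Disj_assoc Disj_commute[of "compl (abs_formula b)"]
          elim!: derivable_mono)
  qed
next
  case (EOr a b)
  let ?v = "\<lambda>c. if eeval \<alpha> c then abs_formula c else compl (abs_formula c)"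
  have IH: "derivable \<D> \<Gamma> (3 * esize a + 2) (G \<^bold>\<or> ?v a)"
    "derivable \<D> \<Gamma> (3 * esize b + 2) (G \<^bold>\<or> ?v b)"
    using EOr by simp_all
  have D: "G \<^bold>\<or> (compl (abs_formula a) \<^bold>\<and> compl (abs_formula b)) \<in> \<D>"
    "G \<^bold>\<or> (abs_formula a \<^bold>\<or> abs_formula b) \<in> \<D>"
    using EOr.prems(1)[of "EOr a b"] by (simp_all add: abs_formula_simps)
  consider "\<not> eeval \<alpha> a" "\<not> eeval \<alpha> b" | "eeval \<alpha> a" | "eeval \<alpha> b"
    by blast
  then show ?case
  proof cases
    case 1
    then show ?thesis
      using derivable_conj[of \<D> \<Gamma> _ G, OF _ _ D(1)] IH
      by (simp add: abs_formula_simps) (fastforce elim: derivable_mono)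
  next
    case 2
    then show ?thesis
      using derivable_weakening[OF IH(1), of "abs_formula b"] D(2)
      by (auto simp: abs_formula_simps Disj_assoc elim!: derivable_mono)
  next
    case 3
    then show ?thesis
      using derivable_weakening[OF IH(2), of "abs_formula a"] D(2)
      by (auto simp: abs_formula_simps Disj_assoc Disj_commute[of "abs_formula b"]
          elim!: derivable_mono)
  qed
qed

section \<open>Cutting away the variables\<close>

text \<open>Cutting on one variable turns \<open>k\<close> lines into \<open>2 * k + 1\<close>, that
  is, it doubles \<open>k + 1\<close>.\<close>

lemma derivable_cut_vars:
  assumes "distinct xs"
    and "\<And>\<alpha>. derivable \<D> \<Gamma> k (disjs (map (false_lit \<alpha>) xs) A)"
    and "\<And>\<alpha> ys. suffix ys xs \<Longrightarrow> disjs (map (false_lit \<alpha>) ys) A \<in> \<D>"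
  shows "derivable \<D> \<Gamma> (2 ^ length xs * (k + 1)) A"
  using assms
proof (induction xs arbitrary: k)
  case Nil
  then show ?case
    by (auto elim: derivable_mono)
next
  case (Cons x xs)
  have "derivable \<D> \<Gamma> (k + k + 1) (disjs (map (false_lit \<alpha>) xs) A)" for \<alpha>
  proof -
    let ?L = "disjs (map (false_lit \<alpha>) xs) A"
    \<comment> \<open>By distinctness \<open>x\<close> is not in \<open>xs\<close>, so the two
      assignments differing at \<open>x\<close> give the same remaining literals and their
      disjunctions can be cut on \<open>x\<close>.\<close>
    have *: "map (false_lit (\<alpha>(x := t))) xs = map (false_lit \<alpha>) xs" for t
      using Cons.prems(1) by (auto simp: false_lit_def)
    have "derivable \<D> \<Gamma> k (?L \<^bold>\<or> Pos x)" "derivable \<D> \<Gamma> k (?L \<^bold>\<or> compl (Pos x))"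
      using Cons.prems(2)[of "\<alpha>(x := False)"] Cons.prems(2)[of "\<alpha>(x := True)"]
      unfolding list.map foldr.simps * by (simp_all add: false_lit_def Disj_commute[of ?L])
    moreover have "?L \<in> \<D>"
      using Cons.prems(3)[of xs] by (simp add: suffix_Cons)
    ultimately show ?thesis
      using derivable_cut[of \<D> \<Gamma> k ?L "Pos x" k ?L] by simp
  qed
  then have "derivable \<D> \<Gamma> (2 ^ length xs * (k + k + 1 + 1)) A"
    using Cons.prems by (intro Cons.IH) (auto simp: suffix_Cons)
  then show ?case
    by (simp add: algebra_simps mult_2)
qed

section \<open>From entailment to a derivation\<close>

lemma lits_in_class:
  assumes "closed_under_subformulas \<C>" "closed_under_compl \<C>" "F \<in> disj_closure \<C>" "x \<in> vars F"
  shows "Pos x \<in> \<C>" "Neg x \<in> \<C>"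
proof -
  obtain a where a: "a \<in> exprs F"
    using exprs_nonempty by blast
  then have "Pos x \<in> \<C> \<and> Neg x \<in> \<C>"
    using splits_in_evars[OF assms(1,2) _ splits_in_disj_closure[OF assms(1,3) a], of x] assms(4)
    by (simp add: vars_eq_evars exprs_def)
  then show "Pos x \<in> \<C>" "Neg x \<in> \<C>"
    by auto
qed

lemma fsize_lits: "fsize (Pos x) \<le> 1" "fsize (Neg x) \<le> 1"
  using fsize_abs_formula[of "EPos x"] fsize_abs_formula[of "ENeg x"]
  by (simp_all add: abs_formula_simps)

text \<open>The longest formulas are disjunctions of at most \<open>s + 1\<close> parts with all
  literals and \<open>A\<close>, of size at most
  \<open>(s + 1) * (s + 1) + 2 * length xs + s\<close>. The excluded middle of a variable has size
  at most 3 and fits as well.\<close>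

lemma derivable_of_entails:
  assumes sub: "closed_under_subformulas \<C>" and cmp: "closed_under_compl \<C>"
    and \<Gamma>: "insert A \<Gamma> \<subseteq> disj_closure \<C>"
    and ent: "entails \<Gamma> A"
    and vars: "set xs = (\<Union>F \<in> insert A \<Gamma>. vars F)" "distinct xs"
    and size: "\<And>F. F \<in> insert A \<Gamma> \<Longrightarrow> fsize F \<le> s"
  defines "\<D> \<equiv> {F \<in> disj_closure \<C>. fsize F \<le> 2 * length xs + s * s + 4 * s + 4}"
  shows "derivable \<D> \<Gamma> (2 ^ length xs * (3 * s * s + 6 * s + 6)) A"
proof -
  have lit: "Pos x \<in> \<C>" "Neg x \<in> \<C>" if "x \<in> set xs" for x
    using lits_in_class[OF sub cmp, of _ x] that \<Gamma> unfolding vars(1) by blast+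
  define L where "L \<alpha> ys = disjs (map (false_lit \<alpha>) ys) A" for \<alpha> ys
  have L: "L \<alpha> ys \<in> disj_closure \<C>" "fsize (L \<alpha> ys) \<le> 2 * length xs + s"
    if "suffix ys xs" for \<alpha> ys
  proof -
    have "set ys \<subseteq> set xs" "length ys \<le> length xs"
      using that by (auto dest: set_mono_suffix suffix_length_le)
    then show "L \<alpha> ys \<in> disj_closure \<C>"
      unfolding L_def using lit \<Gamma>
      by (intro disjs_in_disj_closure) (auto simp: false_lit_def intro!: disj_closure.base)
    have "fsize (L \<alpha> ys) \<le> length (map (false_lit \<alpha>) ys) * (1 + 1) + fsize A"
      unfolding L_def using fsize_lits by (intro fsize_disjs) (auto simp: false_lit_def simp del: One_nat_def)
    then show "fsize (L \<alpha> ys) \<le> 2 * length xs + s"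
      using \<open>length ys \<le> length xs\<close> size[of A] by simp
  qed
  have val: "derivable \<D> \<Gamma> (3 * s + 2)
      (L \<alpha> xs \<^bold>\<or> (if eeval \<alpha> b then abs_formula b else compl (abs_formula b)))"
    if b: "abs_formula ` esubs b \<subseteq> \<C>" "esize b \<le> s" "evars b \<subseteq> set xs" for \<alpha> b
  proof (rule derivable_mono[OF derivable_value])
    fix c assume "c \<in> esubs b"
    then have c: "abs_formula c \<in> \<C>" "compl (abs_formula c) \<in> \<C>" "fsize (abs_formula c) \<le> s"
      "fsize (compl (abs_formula c)) \<le> s"
      using b cmp esize_esubs[of c b] fsize_abs_formula[of c] fsize_compl[of "abs_formula c"]
      by (auto simp: closed_under_compl_def)
    then show "L \<alpha> xs \<^bold>\<or> abs_formula c \<in> \<D> \<and> L \<alpha> xs \<^bold>\<or> compl (abs_formula c) \<in> \<D>"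
      using L[of xs \<alpha>] fsize_Disj[of "L \<alpha> xs" "abs_formula c"]
        fsize_Disj[of "L \<alpha> xs" "compl (abs_formula c)"]
      by (auto simp: \<D>_def intro: disj_closure.intros)
  next
    fix x assume "x \<in> evars b"
    then show "Pos x \<^bold>\<or> Neg x \<in> \<D>"
      using lit[of x] b(3) fsize_Disj[of "Pos x" "Neg x"] fsize_lits[of x]
      by (auto simp: \<D>_def intro: disj_closure.intros)
    show "false_lit \<alpha> x \<^bold>\<or> L \<alpha> xs = L \<alpha> xs"
      using \<open>x \<in> evars b\<close> b(3) unfolding L_def by (intro disjs_absorb) auto
  qed (use b in simp)
  have "derivable \<D> \<Gamma> (3 * s * s + 6 * s + 5) (L \<alpha> xs)" for \<alpha>
  proof (cases "holds \<alpha> A")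
    case True
    have A: "A \<in> disj_closure \<C>" "fsize A \<le> s"
      using \<Gamma> size by auto
    obtain bs where "length bs \<le> s + 1"
      and bs: "\<And>b. b \<in> set bs \<Longrightarrow> abs_formula ` esubs b \<subseteq> \<C>"
      "\<And>b. b \<in> set bs \<Longrightarrow> esize b \<le> s" "\<And>b. b \<in> set bs \<Longrightarrow> evars b \<subseteq> vars A"
      "\<And>G. A \<^bold>\<or> G = disjs (map abs_formula bs) G"
      "\<And>\<alpha>. holds \<alpha> A \<longleftrightarrow> (\<exists>b \<in> set bs. eeval \<alpha> b)"
      by (rule disj_closure_parts[OF sub A]) (rule that)
    obtain b where b: "b \<in> set bs" "eeval \<alpha> b"
      using True bs(5) by blast
    have "abs_formula b \<^bold>\<or> (A \<^bold>\<or> L \<alpha> xs) = A \<^bold>\<or> L \<alpha> xs"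
      unfolding bs(4) using b(1) by (intro disjs_absorb) simp
    \<comment> \<open>The true part is absorbed by \<open>A\<close>, and \<open>A\<close> is the
      base of \<open>L \<alpha> xs\<close>.\<close>
    then have "L \<alpha> xs \<^bold>\<or> abs_formula b = L \<alpha> xs"
      by (simp add: L_def disjs_absorb_base Disj_commute)
    moreover have "evars b \<subseteq> set xs"
      using bs(3)[OF b(1)] vars(1) by blast
    ultimately show ?thesis
      using val[of b \<alpha>] bs b by (auto elim: derivable_mono)
  next
    case False
    then obtain B where B: "B \<in> \<Gamma>" "\<not> holds \<alpha> B"
      using ent by (auto simp: entails_def)
    then have B': "B \<in> disj_closure \<C>" "fsize B \<le> s" "vars B \<subseteq> set xs"
      using \<Gamma> size vars(1) by auto
    obtain bs where len: "length bs \<le> s + 1"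
      and bs: "\<And>b. b \<in> set bs \<Longrightarrow> abs_formula ` esubs b \<subseteq> \<C>"
      "\<And>b. b \<in> set bs \<Longrightarrow> esize b \<le> s" "\<And>b. b \<in> set bs \<Longrightarrow> evars b \<subseteq> vars B"
      "\<And>G. B \<^bold>\<or> G = disjs (map abs_formula bs) G"
      "\<And>\<alpha>. holds \<alpha> B \<longleftrightarrow> (\<exists>b \<in> set bs. eeval \<alpha> b)"
      by (rule disj_closure_parts[OF sub B'(1,2)]) (rule that)
    have part: "disjs Fs (L \<alpha> xs) \<in> \<D>" if "suffix Fs (map abs_formula bs)" for Fs
    proof -
      have Fs: "set Fs \<subseteq> abs_formula ` set bs" "length Fs \<le> s + 1"
        using set_mono_suffix[OF that] suffix_length_le[OF that] len by auto
      have F: "F \<in> disj_closure \<C>" "fsize F \<le> s" if mem: "F \<in> set Fs" for F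
      proof -
        obtain b where b: "b \<in> set bs" "F = abs_formula b"
          using mem Fs(1) by blast
        show "F \<in> disj_closure \<C>"
          using bs(1)[OF b(1)] self_in_esubs[of b] b(2) by (blast intro: disj_closure.base)
        show "fsize F \<le> s"
          unfolding b(2) using fsize_abs_formula bs(2)[OF b(1)] by (rule order_trans)
      qed
      have "fsize (disjs Fs (L \<alpha> xs)) \<le> length Fs * (s + 1) + fsize (L \<alpha> xs)"
        using F(2) by (rule fsize_disjs)
      also have "\<dots> \<le> (s + 1) * (s + 1) + (2 * length xs + s)"
        using Fs(2) L(2)[of xs \<alpha>] by (intro add_mono mult_right_mono) auto
      also have "\<dots> \<le> 2 * length xs + s * s + 4 * s + 4"
        by simp
      finally show ?thesis
        using disjs_in_disj_closure[of Fs \<C> "L \<alpha> xs"] F(1) L(1)[of xs \<alpha>] by (auto simp: \<D>_def)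
    qed
    have "derivable \<D> \<Gamma> 1 B"
      using B(1) B'(1,2) by (intro derivable_hyp) (auto simp: \<D>_def)
    \<comment> \<open>One line for the hypothesis \<open>B\<close>, one for weakening it by
      \<open>L \<alpha> xs\<close>.\<close>
    then have "derivable \<D> \<Gamma> (1 + 1) (disjs (map abs_formula bs) (L \<alpha> xs))"
      unfolding bs(4)[symmetric] using part[of "map abs_formula bs"]
      by (intro derivable_weakening) (auto simp: bs(4))
    then have "derivable \<D> \<Gamma> (1 + 1 + length (map abs_formula bs) * (3 * s + 2 + 1)) (L \<alpha> xs)"
    proof (rule derivable_cut_disjs[OF _ _ part])
      fix F assume "F \<in> set (map abs_formula bs)"
      then obtain b where b: "b \<in> set bs" "F = abs_formula b"
        by auto
      then show "derivable \<D> \<Gamma> (3 * s + 2) (L \<alpha> xs \<^bold>\<or> compl F)"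
        \<comment> \<open>As \<open>B\<close> is false under \<open>\<alpha>\<close>, so is each of
          its parts, and \<open>val\<close> yields the complement.\<close>
        using val[of b \<alpha>] bs(1,2,5) subset_trans[OF bs(3) B'(3)] B(2) by auto
    qed
    then show ?thesis
    proof (rule derivable_mono)
      have "length bs * (3 * s + 3) \<le> (s + 1) * (3 * s + 3)"
        using len by (intro mult_right_mono) auto
      then show "1 + 1 + length (map abs_formula bs) * (3 * s + 2 + 1) \<le> 3 * s * s + 6 * s + 5"
        by (simp add: algebra_simps)
    qed
  qed
  moreover have "L \<alpha> ys \<in> \<D>" if "suffix ys xs" for \<alpha> ys
    using L[OF that, of \<alpha>] by (auto simp: \<D>_def)
  \<comment> \<open>The final \<open>+ 1\<close> comes from \<open>k + 1\<close> in
    \<open>derivable_cut_vars\<close>.\<close>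
  ultimately have "derivable \<D> \<Gamma> (2 ^ length xs * (3 * s * s + 6 * s + 5 + 1)) A"
    unfolding L_def by (intro derivable_cut_vars vars(2)) auto
  then show ?thesis
    by (simp add: numeral_eq_Suc)
qed

section \<open>The polynomial bound\<close>

lemma proof_size_le:
  "(\<And>F. F \<in> set P \<Longrightarrow> fsize F \<le> M) \<Longrightarrow> proof_size P \<le> length P * M"
  unfolding proof_size_def by (induction P) (auto intro: add_mono)


theorem theorem2p1:
  "\<exists>p. polynomial5 p \<and>
     (\<forall>(\<C> :: 'v formula set) (As :: 'v formula list) (A :: 'v formula) (n :: nat) (s :: nat) (m :: nat).
        closed_under_subformulas \<C> \<longrightarrow>
        closed_under_compl \<C> \<longrightarrow>
        length As = m \<longrightarrow>
        set As \<subseteq> disj_closure \<C> \<longrightarrow>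
        A \<in> disj_closure \<C> \<longrightarrow>
        entails (set As) A \<longrightarrow>
        card (\<Union>F \<in> insert A (set As). vars F) = n \<longrightarrow>
        (\<forall>F \<in> insert A (set As). fsize F \<le> s) \<longrightarrow>
        (\<exists>P. class_frege_proof (disj_closure \<C>) (set As) A P \<and>
             proof_size P \<le> p n s m (2 ^ n) (s ^ m)))"
proof -
  \<comment> \<open>Number of lines times largest formula size, with \<open>e\<close> standing for
    \<open>2 ^ n\<close>.\<close>
  let ?p = "\<lambda>n s (m::nat) e (q::nat). (e * (3 * s * s + 6 * s + 6)) * (2 * n + s * s + 4 * s + 4) :: nat"
  have "polynomial5 ?p"
    unfolding polynomial5_def
    \<comment> \<open>The product multiplied out: each tuple holds a coefficient and the exponents
      of \<open>n\<close>, \<open>s\<close>, \<open>m\<close>, \<open>2 ^ n\<close> and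
      \<open>s ^ m\<close>.\<close>
    by (rule exI[of _ "[(3,0,4,0,1,0), (18,0,3,0,1,0), (42,0,2,0,1,0), (48,0,1,0,1,0),
        (24,0,0,0,1,0), (6,1,2,0,1,0), (12,1,1,0,1,0), (12,1,0,0,1,0)]"])
      (simp add: fun_eq_iff algebra_simps power_numeral_reduce)
  moreover have "\<exists>P. class_frege_proof (disj_closure \<C>) (set As) A P \<and> proof_size P \<le> ?p n s m (2 ^ n) (s ^ m)"
    if closed: "closed_under_subformulas \<C>" "closed_under_compl \<C>"
      and As: "set As \<subseteq> disj_closure \<C>" "A \<in> disj_closure \<C>" "entails (set As) A"
      and n: "card (\<Union>F \<in> insert A (set As). vars F) = n"
      and s: "\<forall>F \<in> insert A (set As). fsize F \<le> s"
    for \<C> :: "'v formula set" and As A n s m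
  proof -
    obtain xs where xs: "set xs = (\<Union>F \<in> insert A (set As). vars F)" "distinct xs"
      using finite_distinct_list[of "\<Union>F \<in> insert A (set As). vars F"] by (auto simp: finite_vars)
    then have "length xs = n"
      using n distinct_card by metis
    then obtain P where P: "class_frege_proof
        {F \<in> disj_closure \<C>. fsize F \<le> 2 * n + s * s + 4 * s + 4} (set As) A P"
      "length P \<le> 2 ^ n * (3 * s * s + 6 * s + 6)"
      using derivable_of_entails[OF closed _ As(3) xs, of s] As s unfolding derivable_def by auto
    then have "proof_size P \<le> length P * (2 * n + s * s + 4 * s + 4)"
      by (intro proof_size_le) (auto simp: class_frege_proof_def)
    also have "\<dots> \<le> (2 ^ n * (3 * s * s + 6 * s + 6)) * (2 * n + s * s + 4 * s + 4)"
      using P(2) by (rule mult_right_mono) simp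
    finally show ?thesis
      using P(1) by (auto simp: class_frege_proof_def)
  qed
  ultimately show ?thesis
    by (intro exI[of _ ?p]) blast
qed

end
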